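(* Let $A$ and $B$ be partial combinatory algebras and let $\gamma : A\to B$ be an applicative morphism. The following statements are equivalent: (i) $\gamma$ is computationally dense; (ii) $\tilde{\gamma}:T(A)\to T(B)$ has a right adjoint in the 2-category of order-pcas; (iii) there is an applicative morphism $\delta : B\to A$ such that $\gamma\delta\leq \mathrm{id}_B$.
   Context: Partial combinatory algebras. A pca is a set $A$ with a partial binary application $(a,b)\mapsto ab$ (associating to the left) for which there exist $\mathsf{k},\mathsf{s}\in A$ such that for all $a,b,c\in A$: $\mathsf{k}ab=a$; $\mathsf{s}ab$ is defined; and whenever $ac(bc)$ is defined, $\mathsf{s}abc$ is defined and equal to it. $t{\downarrow}$ means "$t$ is defined". For $b\in B$, $\beta\subseteq B$: $b\beta{\downarrow}$ means $bx{\downarrow}$ for all $x\in\beta$, and then $b\beta=\{bx\mid x\in\beta\}$. Applicative morphisms of pcas. An applicative morphism $\gamma:A\to B$ assigns to each $a\in A$ a nonempty subset $\gamma(a)\subseteq B$ such that there is $r\in B$ with: whenever $aa'{\downarrow}$, $b\in\gamma(a)$, $b'\in\gamma(a')$, then $rbb'{\downarrow}$ and $rbb'\in\gamma(aa')$. For $\gamma,\delta:A\to B$, $\gamma\leq\delta$ means there is $s\in B$ such that for all $a\in A$, $b\in\gamma(a)$: $sb{\downarrow}$ and $sb\in\delta(a)$. Composition is composition of relations: $(\delta\gamma)(a)=\bigcup_{b\in\gamma(a)}\delta(b)$; $\mathrm{id}_B(b)=\{b\}$. Computational density. $\gamma:A\to B$ is computationally dense if there is $m\in B$ such that for every $b\in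 B$ there is $a\in A$ such that for all $a'\in A$: if $b\gamma(a'){\downarrow}$ then $aa'{\downarrow}$, $m\gamma(aa'){\downarrow}$ and $m\gamma(aa')\subseteq b\gamma(a')$. Order-pcas. An order-pca is a poset $P$ with a partial binary application and elements $\mathsf{k},\mathsf{s}$ such that: if $ab{\downarrow}$, $a'\leq a$, $b'\leq b$ then $a'b'{\downarrow}$ and $a'b'\leq ab$; $\mathsf{k}ab\leq a$; $\mathsf{s}ab{\downarrow}$, and whenever $ac(bc){\downarrow}$, $\mathsf{s}abc{\downarrow}$ and $\mathsf{s}abc\leq ac(bc)$. An applicative morphism of order-pcas $P\to Q$ is a function $f:P\to Q$ such that there is $r\in Q$ with: whenever $aa'{\downarrow}$, $rf(a)f(a'){\downarrow}$ and $rf(a)f(a')\leq f(aa')$; and there is $u\in Q$ with: whenever $a\leq a'$, $uf(a){\downarrow}$ and $uf(a)\leq f(a')$. For such $f,g:P\to Q$, $f\leq g$ means there is $s\in Q$ with $sf(a){\downarrow}$ and $sf(a)\leq g(a)$ for all $a\in P$. This gives a preorder-enriched category (the 2-category of order-pcas); $g:Q\to P$ is right adjoint to $f:P\to Q$ if $\mathrm{id}_P\leq gf$ and $fg\leq\mathrm{id}_Q$. For a pca $A$, $T(A)$ is the order-pca of nonempty subsets of $A$ ordered by inclusion, with $\alpha\beta{\downarrow}$ iff $ab{\downarrow}$ for all $a\in\alpha,b\in\beta$, and then $\alpha\beta=\{ab\mid a\in\alpha,b\in\beta\}$. For an applicative morphism $\gamma:A\to B$ of pcas, $\tilde\gamma:T(A)\to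 T(B)$ is the applicative morphism of order-pcas $\tilde\gamma(\alpha)=\bigcup_{a\in\alpha}\gamma(a)$. *)

theory Defs
  imports Main
begin

section \<open>Partial applicative structures\<close>

record 'a pas =
  carrier :: "'a set"
  app :: "'a \<Rightarrow> 'a \<Rightarrow> 'a option"

text \<open>Terms denote elements of an option type, and \<open>None\<close> means undefined. Application of
  terms is strict, and a term \<open>t\<close> is defined iff \<open>t \<noteq> None\<close>.\<close>

definition term_app :: "('a, 'z) pas_scheme \<Rightarrow> 'a option \<Rightarrow> 'a option \<Rightarrow> 'a option"
    (infixl "\<cdot>\<index>" 70) where
  "t \<cdot>\<^bsub>M\<^esub> u = Option.bind t (\<lambda>a. Option.bind u (app M a))"

locale pas =
  fixes A :: "('a, 'z) pas_scheme" (structure)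
  assumes app_closed: "a \<in> carrier A \<Longrightarrow> b \<in> carrier A \<Longrightarrow> app A a b = Some c \<Longrightarrow> c \<in> carrier A"

definition elt_set_defined :: "('a, 'z) pas_scheme \<Rightarrow> 'a \<Rightarrow> 'a set \<Rightarrow> bool" where
  "elt_set_defined M b \<beta> \<longleftrightarrow> (\<forall>x\<in>\<beta>. app M b x \<noteq> None)"

text \<open>This set is only meaningful as a value of \<open>b\<beta>\<close> when \<open>elt_set_defined M b \<beta>\<close> holds.\<close>

definition elt_set_app :: "('a, 'z) pas_scheme \<Rightarrow> 'a \<Rightarrow> 'a set \<Rightarrow> 'a set" where
  "elt_set_app M b \<beta> = {c. \<exists>x\<in>\<beta>. app M b x = Some c}"


section \<open>Partial combinatory algebras\<close>

locale pca = pas A for A :: "('a, 'z) pas_scheme" (structure) +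
  assumes combinators:
    "\<exists>k\<in>carrier A. \<exists>s\<in>carrier A. \<forall>a\<in>carrier A. \<forall>b\<in>carrier A. \<forall>c\<in>carrier A.
       Some k \<cdot> Some a \<cdot> Some b = Some a \<and>
       Some s \<cdot> Some a \<cdot> Some b \<noteq> None \<and>
       (Some a \<cdot> Some c \<cdot> (Some b \<cdot> Some c) \<noteq> None \<longrightarrow>
          Some s \<cdot> Some a \<cdot> Some b \<cdot> Some c = Some a \<cdot> Some c \<cdot> (Some b \<cdot> Some c))"

text \<open>Values of a morphism outside the carrier are left unconstrained. This is harmless because
  morphisms are only ever compared by the preorder, which quantifies over the carrier.\<close>

locale applicative_morphism = A: pca A + B: pca B
  for A :: "('a, 'y) pas_scheme" and B :: "('b, 'z) pas_scheme" +
  fixes \<gamma> :: "'a \<Rightarrow> 'b set"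
  assumes nonempty_subset: "a \<in> carrier A \<Longrightarrow> \<gamma> a \<noteq> {} \<and> \<gamma> a \<subseteq> carrier B"
    and realizer:
      "\<exists>r\<in>carrier B. \<forall>a\<in>carrier A. \<forall>a'\<in>carrier A. \<forall>d. app A a a' = Some d \<longrightarrow>
         (\<forall>b\<in>\<gamma> a. \<forall>b'\<in>\<gamma> a'.
            \<exists>e. Some r \<cdot>\<^bsub>B\<^esub> Some b \<cdot>\<^bsub>B\<^esub> Some b' = Some e \<and> e \<in> \<gamma> d)"

definition morphism_le ::
    "('a, 'y) pas_scheme \<Rightarrow> ('b, 'z) pas_scheme \<Rightarrow> ('a \<Rightarrow> 'b set) \<Rightarrow> ('a \<Rightarrow> 'b set) \<Rightarrow> bool" where
  "morphism_le A B \<gamma> \<delta> \<longleftrightarrow>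
     (\<exists>s\<in>carrier B. \<forall>a\<in>carrier A. \<forall>b\<in>\<gamma> a. \<exists>c. app B s b = Some c \<and> c \<in> \<delta> a)"

definition morphism_comp :: "('b \<Rightarrow> 'c set) \<Rightarrow> ('a \<Rightarrow> 'b set) \<Rightarrow> 'a \<Rightarrow> 'c set" where
  "morphism_comp \<delta> \<gamma> a = (\<Union>b\<in>\<gamma> a. \<delta> b)"

definition morphism_id :: "'a \<Rightarrow> 'a set" where
  "morphism_id a = {a}"

definition computationally_dense ::
    "('a, 'y) pas_scheme \<Rightarrow> ('b, 'z) pas_scheme \<Rightarrow> ('a \<Rightarrow> 'b set) \<Rightarrow> bool" where
  "computationally_dense A B \<gamma> \<longleftrightarrow>
     (\<exists>m\<in>carrier B. \<forall>b\<in>carrier B. \<exists>a\<in>carrier A. \<forall>a'\<in>carrier A.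
        elt_set_defined B b (\<gamma> a') \<longrightarrow>
        (\<exists>d. app A a a' = Some d \<and> elt_set_defined B m (\<gamma> d) \<and>
             elt_set_app B m (\<gamma> d) \<subseteq> elt_set_app B b (\<gamma> a')))"


section \<open>Order-pcas\<close>

record 'a opas = "'a pas" +
  le :: "'a rel"

locale order_pca = pas P for P :: "('a, 'z) opas_scheme" (structure) +
  assumes poset: "partial_order_on (carrier P) (le P)"
    and app_mono:
      "a \<in> carrier P \<Longrightarrow> b \<in> carrier P \<Longrightarrow> a' \<in> carrier P \<Longrightarrow> b' \<in> carrier P \<Longrightarrow>
       app P a b = Some c \<Longrightarrow> (a', a) \<in> le P \<Longrightarrow> (b', b) \<in> le P \<Longrightarrow>
       \<exists>c'. app P a' b' = Some c' \<and> (c', c) \<in> le P"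
    and combinators:
      "\<exists>k\<in>carrier P. \<exists>s\<in>carrier P. \<forall>a\<in>carrier P. \<forall>b\<in>carrier P. \<forall>c\<in>carrier P.
         (\<exists>d. Some k \<cdot> Some a \<cdot> Some b = Some d \<and> (d, a) \<in> le P) \<and>
         Some s \<cdot> Some a \<cdot> Some b \<noteq> None \<and>
         (\<forall>e. Some a \<cdot> Some c \<cdot> (Some b \<cdot> Some c) = Some e \<longrightarrow>
            (\<exists>d. Some s \<cdot> Some a \<cdot> Some b \<cdot> Some c = Some d \<and> (d, e) \<in> le P))"

locale order_morphism = P: order_pca P + Q: order_pca Q
  for P :: "('p, 'y) opas_scheme" and Q :: "('q, 'z) opas_scheme" +
  fixes f :: "'p \<Rightarrow> 'q"
  assumes maps: "a \<in> carrier P \<Longrightarrow> f a \<in> carrier Q"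
    and realizer:
      "\<exists>r\<in>carrier Q. \<forall>a\<in>carrier P. \<forall>a'\<in>carrier P. \<forall>d. app P a a' = Some d \<longrightarrow>
         (\<exists>e. Some r \<cdot>\<^bsub>Q\<^esub> Some (f a) \<cdot>\<^bsub>Q\<^esub> Some (f a') = Some e \<and> (e, f d) \<in> le Q)"
    and order_realizer:
      "\<exists>u\<in>carrier Q. \<forall>a\<in>carrier P. \<forall>a'\<in>carrier P. (a, a') \<in> le P \<longrightarrow>
         (\<exists>e. app Q u (f a) = Some e \<and> (e, f a') \<in> le Q)"

definition order_morphism_le ::
    "('p, 'y) opas_scheme \<Rightarrow> ('q, 'z) opas_scheme \<Rightarrow> ('p \<Rightarrow> 'q) \<Rightarrow> ('p \<Rightarrow> 'q) \<Rightarrow> bool" where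
  "order_morphism_le P Q f g \<longleftrightarrow>
     (\<exists>s\<in>carrier Q. \<forall>a\<in>carrier P. \<exists>e. app Q s (f a) = Some e \<and> (e, g a) \<in> le Q)"

definition right_adjoint ::
    "('p, 'y) opas_scheme \<Rightarrow> ('q, 'z) opas_scheme \<Rightarrow> ('p \<Rightarrow> 'q) \<Rightarrow> ('q \<Rightarrow> 'p) \<Rightarrow> bool" where
  "right_adjoint P Q f g \<longleftrightarrow>
     order_morphism P Q f \<and> order_morphism Q P g \<and>
     order_morphism_le P P id (g \<circ> f) \<and> order_morphism_le Q Q (f \<circ> g) id"


section \<open>The order-pca of nonempty subsets\<close>

definition T :: "('a, 'z) pas_scheme \<Rightarrow> 'a set opas" where
  "T A =
     \<lparr>carrier = {\<alpha>. \<alpha> \<subseteq> carrier A \<and> \<alpha> \<noteq> {}},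
      app = (\<lambda>\<alpha> \<beta>. if \<forall>a\<in>\<alpha>. \<forall>b\<in>\<beta>. app A a b \<noteq> None
                     then Some {c. \<exists>a\<in>\<alpha>. \<exists>b\<in>\<beta>. app A a b = Some c} else None),
      le = {(\<alpha>, \<beta>). \<alpha> \<subseteq> carrier A \<and> \<alpha> \<noteq> {} \<and> \<beta> \<subseteq> carrier A \<and> \<beta> \<noteq> {} \<and> \<alpha> \<subseteq> \<beta>}\<rparr>"

definition tilde :: "('a \<Rightarrow> 'b set) \<Rightarrow> 'a set \<Rightarrow> 'b set" where
  "tilde \<gamma> \<alpha> = (\<Union>a\<in>\<alpha>. \<gamma> a)"

end

theory Submission
  imports Defs
begin

text \<open>The equivalence is proved in a cycle. If \<open>m\<close> witnesses that \<open>\<gamma>\<close> is computationally dense,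
  then \<open>\<beta> \<mapsto> {a. m\<gamma>(a)\<down> and m\<gamma>(a) \<subseteq> \<beta>}\<close> is right adjoint to \<open>tilde \<gamma>\<close>: it tracks application because
  density pulls back to \<open>A\<close> the element of \<open>B\<close> that decodes a pair, applies \<open>m\<close> to both components
  and then applies the first result to the second. A right adjoint \<open>g\<close> yields \<open>\<delta>(b) = g({b})\<close>.
  Finally, given \<open>\<delta>\<close> and a realizer \<open>s\<close> of \<open>\<gamma>\<delta> \<le> id\<close>, the element \<open>m\<close> that sends a realizer of a
  pair \<open>(d, a)\<close> with \<open>d \<in> \<delta>(b)\<close> to the value of \<open>b\<close> (recovered by \<open>s\<close>) on a realizer of \<open>a\<close>
  shows density.\<close>

section \<open>Polynomials over a pca and combinatory completeness\<close>

lemma term_app_Some [simp]: "Some a \<cdot>\<^bsub>M\<^esub> Some b = app M a b"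
  by (simp add: term_app_def)

lemma term_app_eq_Some_iff:
  "t \<cdot>\<^bsub>M\<^esub> u = Some c \<longleftrightarrow> (\<exists>a b. t = Some a \<and> u = Some b \<and> app M a b = Some c)"
  by (cases t; cases u) (auto simp: term_app_def)

text \<open>These are polynomials. The set function \<open>params\<close> collects their constants,
  so \<open>params t \<subseteq> carrier A\<close> says that \<open>t\<close> is a polynomial over
  \<open>A\<close>. The type of variables is left open: \<open>unit\<close> gives one variable and
  \<open>bool\<close> gives two.\<close>

datatype ('v, params: 'a) pca_term =
  Var 'v | Const 'a | App "('v, 'a) pca_term" "('v, 'a) pca_term"

primrec eval_term :: "('a, 'z) pas_scheme \<Rightarrow> ('v \<Rightarrow> 'a) \<Rightarrow> ('v, 'a) pca_term \<Rightarrow> 'a option" where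
  "eval_term M \<rho> (Var n) = Some (\<rho> n)"
| "eval_term M \<rho> (Const a) = Some a"
| "eval_term M \<rho> (App t u) = eval_term M \<rho> t \<cdot>\<^bsub>M\<^esub> eval_term M \<rho> u"

text \<open>Bracket abstraction, with \<open>s k k\<close> as the identity. An application is always
  abstracted through \<open>s\<close>, even if the variable does not occur in it: the shortcut
  \<open>k (t u)\<close> would be undefined whenever \<open>t u\<close> is, whereas
  \<open>s f g\<close> is always defined.\<close>

primrec abstract :: "'a \<Rightarrow> 'a \<Rightarrow> 'v \<Rightarrow> ('v, 'a) pca_term \<Rightarrow> ('v, 'a) pca_term" where
  "abstract k s n (Var m) =
     (if m = n then App (App (Const s) (Const k)) (Const k) else App (Const k) (Var m))"
| "abstract k s n (Const a) = App (Const k) (Const a)"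
| "abstract k s n (App t u) = App (App (Const s) (abstract k s n t)) (abstract k s n u)"

context pca
begin

text \<open>The laws of \<open>k\<close> and \<open>s\<close> are restated with names for the
  intermediate values \<open>k a\<close> and \<open>s f g\<close>, which are thereby known to exist
  and to lie in the carrier.\<close>

definition ks_pair :: "'a \<Rightarrow> 'a \<Rightarrow> bool" where
  "ks_pair k s \<longleftrightarrow> k \<in> carrier A \<and> s \<in> carrier A \<and>
     (\<forall>a\<in>carrier A. \<exists>f\<in>carrier A. app A k a = Some f \<and> (\<forall>x\<in>carrier A. app A f x = Some a)) \<and>
     (\<forall>f\<in>carrier A. \<forall>g\<in>carrier A. \<exists>h\<in>carrier A. Some s \<cdot> Some f \<cdot> Some g = Some h \<and>
        (\<forall>x\<in>carrier A. \<forall>v. app A f x \<cdot> app A g x = Some v \<longrightarrow> app A h x = Some v))"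

lemma ks_pairD:
  assumes "ks_pair k s"
  shows "k \<in> carrier A" and "s \<in> carrier A"
    and "a \<in> carrier A \<Longrightarrow>
      \<exists>f\<in>carrier A. app A k a = Some f \<and> (\<forall>x\<in>carrier A. app A f x = Some a)"
    and "f \<in> carrier A \<Longrightarrow> g \<in> carrier A \<Longrightarrow>
      \<exists>h\<in>carrier A. Some s \<cdot> Some f \<cdot> Some g = Some h \<and>
        (\<forall>x\<in>carrier A. \<forall>v. app A f x \<cdot> app A g x = Some v \<longrightarrow> app A h x = Some v)"
  using assms unfolding ks_pair_def by blast+

lemma ks_pair_exists:
  obtains k s where "ks_pair k s"
proof -
  obtain k s where ks: "k \<in> carrier A" "s \<in> carrier A"
    and *: "\<forall>a\<in>carrier A. \<forall>b\<in>carrier A. \<forall>c\<in>carrier A.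
       Some k \<cdot> Some a \<cdot> Some b = Some a \<and> Some s \<cdot> Some a \<cdot> Some b \<noteq> None \<and>
       (Some a \<cdot> Some c \<cdot> (Some b \<cdot> Some c) \<noteq> None \<longrightarrow>
          Some s \<cdot> Some a \<cdot> Some b \<cdot> Some c = Some a \<cdot> Some c \<cdot> (Some b \<cdot> Some c))"
    using combinators by metis
  have "ks_pair k s"
    unfolding ks_pair_def
  proof (intro conjI ballI)
    show "k \<in> carrier A" "s \<in> carrier A" using ks .
  next
    fix a assume a: "a \<in> carrier A"
    have K: "Some k \<cdot> Some a \<cdot> Some x = Some a" if "x \<in> carrier A" for x
      using * a that by blast
    obtain f where f: "app A k a = Some f"
      using K[OF a] by (auto simp: term_app_eq_Some_iff)
    then show "\<exists>f\<in>carrier A. app A k a = Some f \<and> (\<forall>x\<in>carrier A. app A f x = Some a)"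
      using K app_closed[OF ks(1) a f] by auto
  next
    fix f g assume fg: "f \<in> carrier A" "g \<in> carrier A"
    then obtain h where h: "Some s \<cdot> Some f \<cdot> Some g = Some h"
      using * by blast
    then obtain u where "app A s f = Some u" "app A u g = Some h"
      by (auto simp: term_app_eq_Some_iff)
    then have "h \<in> carrier A"
      using app_closed ks(2) fg by blast
    moreover have "app A h x = Some v"
      if x: "x \<in> carrier A" and v: "app A f x \<cdot> app A g x = Some v" for x v
    proof -
      have "Some f \<cdot> Some x \<cdot> (Some g \<cdot> Some x) \<noteq> None" using v by simp
      then have "Some s \<cdot> Some f \<cdot> Some g \<cdot> Some x = Some f \<cdot> Some x \<cdot> (Some g \<cdot> Some x)"
        using * fg x by blast
      then show ?thesis using h v by simp
    qed
    ultimately show "\<exists>h\<in>carrier A. Some s \<cdot> Some f \<cdot> Some g = Some h \<and>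
        (\<forall>x\<in>carrier A. \<forall>v. app A f x \<cdot> app A g x = Some v \<longrightarrow> app A h x = Some v)"
      using h by blast
  qed
  then show ?thesis by (rule that)
qed

text \<open>Induction on \<open>t\<close>. Application is strict, so a value of
  \<open>App t u\<close> gives values to both parts, and the law of \<open>s\<close> combines them.
  The abstraction has a value even where \<open>t\<close> has none. The bound on its constants
  allows a second variable to be abstracted afterwards.\<close>

lemma eval_abstract:
  assumes KS: "ks_pair k s" and \<rho>: "range \<rho> \<subseteq> carrier A" and "params t \<subseteq> carrier A"
  shows "params (abstract k s n t) \<subseteq> carrier A \<and>
     (\<exists>f\<in>carrier A. eval_term A \<rho> (abstract k s n t) = Some f \<and>
        (\<forall>x\<in>carrier A. \<forall>v. eval_term A (\<rho>(n := x)) t = Some v \<longrightarrow> app A f x = Some v))"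
proof -
  note ks = ks_pairD(1,2)[OF KS] and k_app = ks_pairD(3)[OF KS] and s_app = ks_pairD(4)[OF KS]
  show ?thesis
    using assms(3)
  proof (induction t)
    case (Var m)
    show ?case
    proof (cases "m = n")
      case True
      \<comment> \<open>This computes \<open>s k k x = k x (k x) = x\<close>.\<close>
      have "app A k x \<cdot> app A k x = Some x" if "x \<in> carrier A" for x
        using k_app[OF that] by auto
      then show ?thesis
        using True s_app[OF ks(1) ks(1)] ks by auto
    next
      case False
      have "\<rho> m \<in> carrier A" using \<rho> by auto
      with False k_app[of "\<rho> m"] ks show ?thesis by auto
    qed
  next
    case (Const a)
    then show ?case using k_app[of a] ks by auto
  next
    case (App t u)
    then have "params t \<subseteq> carrier A" "params u \<subseteq> carrier A" by auto
    with App.IH obtain f g where f: "f \<in> carrier A" "eval_term A \<rho> (abstract k s n t) = Some f"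
      "\<And>x v. x \<in> carrier A \<Longrightarrow> eval_term A (\<rho>(n := x)) t = Some v \<Longrightarrow> app A f x = Some v"
      and g: "g \<in> carrier A" "eval_term A \<rho> (abstract k s n u) = Some g"
      "\<And>x v. x \<in> carrier A \<Longrightarrow> eval_term A (\<rho>(n := x)) u = Some v \<Longrightarrow> app A g x = Some v"
      by blast
    obtain h where h: "h \<in> carrier A" "Some s \<cdot> Some f \<cdot> Some g = Some h"
      "\<And>x v. x \<in> carrier A \<Longrightarrow> app A f x \<cdot> app A g x = Some v \<Longrightarrow> app A h x = Some v"
      using s_app[OF f(1) g(1)] by blast
    have "app A h x = Some v"
      if x: "x \<in> carrier A" and v: "eval_term A (\<rho>(n := x)) (App t u) = Some v" for x v
    proof (rule h(3)[OF x])
      obtain a b where "eval_term A (\<rho>(n := x)) t = Some a" "eval_term A (\<rho>(n := x)) u = Some b"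
        "app A a b = Some v"
        using v by (auto simp: term_app_eq_Some_iff)
      then show "app A f x \<cdot> app A g x = Some v"
        using f(3)[OF x] g(3)[OF x] by simp
    qed
    then show ?case
      using App h(1,2) f(2) g(2) ks by (auto simp del: fun_upd_apply)
  qed
qed

lemma unary_completeness:
  fixes t :: "(unit, 'a) pca_term"
  assumes "params t \<subseteq> carrier A"
  obtains f where "f \<in> carrier A"
    and "\<And>x v. x \<in> carrier A \<Longrightarrow> eval_term A (\<lambda>_. x) t = Some v \<Longrightarrow> app A f x = Some v"
proof -
  obtain k s where KS: "ks_pair k s" by (rule ks_pair_exists)
  \<comment> \<open>The valuation must start somewhere in the carrier. The choice of
    \<open>k\<close> is arbitrary, since the update overwrites the only variable.\<close>
  have "range (\<lambda>_ :: unit. k) \<subseteq> carrier A" using ks_pairD(1)[OF KS] by auto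
  moreover have "(\<lambda>_ :: unit. k)(() := x) = (\<lambda>_. x)" for x
    by auto
  ultimately show ?thesis
    using eval_abstract[OF KS _ assms, of "\<lambda>_. k" "()"] that by auto
qed

text \<open>Abstracting \<open>True\<close> first and \<open>False\<close> second yields a curried
  function: \<open>x\<close> is the value of \<open>False\<close> and \<open>y\<close> that of
  \<open>True\<close>. The intermediate value \<open>f x\<close> exists for every \<open>x\<close>,
  even if \<open>t\<close> is undefined for all \<open>y\<close>, because an abstraction always has
  a value.\<close>

lemma binary_completeness:
  fixes t :: "(bool, 'a) pca_term"
  assumes t: "params t \<subseteq> carrier A"
  obtains f where "f \<in> carrier A"
    and "\<And>x. x \<in> carrier A \<Longrightarrow> \<exists>g\<in>carrier A. app A f x = Some g \<and>
      (\<forall>y\<in>carrier A. \<forall>v. eval_term A (\<lambda>i. if i then y else x) t = Some v \<longrightarrow> app A g y = Some v)"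
proof -
  obtain k s where KS: "ks_pair k s" by (rule ks_pair_exists)
  have c: "range (\<lambda>_ :: bool. k) \<subseteq> carrier A" using ks_pairD(1)[OF KS] by auto
  have t': "params (abstract k s True t) \<subseteq> carrier A" using eval_abstract[OF KS c t] by blast
  obtain f where f: "f \<in> carrier A" "\<And>x v. x \<in> carrier A \<Longrightarrow>
      eval_term A ((\<lambda>_. k)(False := x)) (abstract k s True t) = Some v \<Longrightarrow> app A f x = Some v"
    using eval_abstract[OF KS c t'] by blast
  show ?thesis
  proof (rule that[OF f(1)])
    fix x assume x: "x \<in> carrier A"
    have x': "range ((\<lambda>_. k)(False := x)) \<subseteq> carrier A" using c x by auto
    have upd: "((\<lambda>_. k)(False := x))(True := y) = (\<lambda>i. if i then y else x)" for y
      by auto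
    show "\<exists>g\<in>carrier A. app A f x = Some g \<and>
      (\<forall>y\<in>carrier A. \<forall>v. eval_term A (\<lambda>i. if i then y else x) t = Some v \<longrightarrow> app A g y = Some v)"
      using eval_abstract[OF KS x' t, of True] f(2)[OF x] unfolding upd by blast
  qed
qed

section \<open>Identity, constants and pairing\<close>

lemma identity_realizer:
  obtains i where "i \<in> carrier A" and "\<And>a. a \<in> carrier A \<Longrightarrow> app A i a = Some a"
proof (rule unary_completeness[of "Var ()"])
  fix f assume f: "f \<in> carrier A"
    "\<And>x v. x \<in> carrier A \<Longrightarrow> eval_term A (\<lambda>_. x) (Var ()) = Some v \<Longrightarrow> app A f x = Some v"
  show thesis
    by (rule that[OF f(1)]) (rule f(2), simp_all)
qed simp

lemma constant_realizer:
  assumes "b \<in> carrier A"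
  obtains f where "f \<in> carrier A" and "\<And>a. a \<in> carrier A \<Longrightarrow> app A f a = Some b"
proof (rule unary_completeness[of "Const b"])
  show "params (Const b :: (unit, 'a) pca_term) \<subseteq> carrier A" using assms by simp
  fix f assume f: "f \<in> carrier A"
    "\<And>x v. x \<in> carrier A \<Longrightarrow> eval_term A (\<lambda>_. x) (Const b) = Some v \<Longrightarrow> app A f x = Some v"
  show thesis
    by (rule that[OF f(1)]) (rule f(2), simp_all)
qed

text \<open>Pairs are coded as \<open>p a b = \<lambda>z. z a b\<close>, with the projections \<open>z \<mapsto> z k\<close> and \<open>z \<mapsto> z k'\<close>,
  where \<open>k a b = a\<close> and \<open>k' a b = b\<close>.\<close>

lemma pairing:
  obtains p p0 p1 where "p \<in> carrier A" and "p0 \<in> carrier A" and "p1 \<in> carrier A"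
    and "\<And>a. a \<in> carrier A \<Longrightarrow> \<exists>pa\<in>carrier A. app A p a = Some pa \<and>
      (\<forall>b\<in>carrier A. \<exists>c\<in>carrier A. app A pa b = Some c \<and> app A p0 c = Some a \<and> app A p1 c = Some b)"
proof -
  obtain k s where KS: "ks_pair k s" by (rule ks_pair_exists)
  note ks = ks_pairD(1,2)[OF KS] and k_app = ks_pairD(3)[OF KS] and s_app = ks_pairD(4)[OF KS]
  obtain i where i: "i \<in> carrier A" "\<And>a. a \<in> carrier A \<Longrightarrow> app A i a = Some a"
    using identity_realizer by blast
  obtain k' where k': "k' \<in> carrier A" "\<And>a. a \<in> carrier A \<Longrightarrow> \<exists>g\<in>carrier A. app A k' a = Some g \<and>
      (\<forall>b\<in>carrier A. app A g b = Some b)"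
    using binary_completeness[of "Var True"] by auto
  obtain p0 where p0: "p0 \<in> carrier A"
      "\<And>x v. x \<in> carrier A \<Longrightarrow> app A x k = Some v \<Longrightarrow> app A p0 x = Some v"
    using unary_completeness[of "App (Var ()) (Const k)"] ks(1) by auto
  obtain p1 where p1: "p1 \<in> carrier A"
      "\<And>x v. x \<in> carrier A \<Longrightarrow> app A x k' = Some v \<Longrightarrow> app A p1 x = Some v"
    using unary_completeness[of "App (Var ()) (Const k')"] k'(1) by auto
  \<comment> \<open>With \<open>a\<close> for \<open>False\<close> and \<open>b\<close> for
    \<open>True\<close>, this is the abstraction of \<open>z\<close> from \<open>z a b\<close>,
    written out by hand: \<open>s (s i (k a)) (k b) z = s i (k a) z (k b z) = i z (k a z) b = z a
    b\<close> whenever \<open>z a b\<close> is defined. The term itself has a value for all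
    \<open>a\<close> and \<open>b\<close>, so pairing is total.\<close>
  define t where
    "t = App (App (Const s) (App (App (Const s) (Const i)) (App (Const k) (Var False))))
             (App (Const k) (Var True))"
  have "params t \<subseteq> carrier A"
    using ks i by (auto simp: t_def)
  then obtain p where p: "p \<in> carrier A" "\<And>a. a \<in> carrier A \<Longrightarrow> \<exists>g\<in>carrier A. app A p a = Some g \<and>
      (\<forall>b\<in>carrier A. \<forall>v. eval_term A (\<lambda>i. if i then b else a) t = Some v \<longrightarrow> app A g b = Some v)"
    using binary_completeness by blast
  have pair: "\<exists>c\<in>carrier A. eval_term A (\<lambda>i. if i then b else a) t = Some c \<and>
      app A c k = Some a \<and> app A c k' = Some b"
    if ab: "a \<in> carrier A" "b \<in> carrier A" for a b
  proof -
    obtain ka where ka: "ka \<in> carrier A" "app A k a = Some ka" "\<And>x. x \<in> carrier A \<Longrightarrow> app A ka x = Some a"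
      using k_app[OF ab(1)] by blast
    obtain kb where kb: "kb \<in> carrier A" "app A k b = Some kb" "\<And>x. x \<in> carrier A \<Longrightarrow> app A kb x = Some b"
      using k_app[OF ab(2)] by blast
    obtain u where u: "u \<in> carrier A" "Some s \<cdot> Some i \<cdot> Some ka = Some u"
      "\<And>z v. z \<in> carrier A \<Longrightarrow> app A z a = Some v \<Longrightarrow> app A u z = Some v"
      using s_app[OF i(1) ka(1)] i(2) ka(3) by auto
    obtain c where c: "c \<in> carrier A" "Some s \<cdot> Some u \<cdot> Some kb = Some c"
      "\<And>z v. z \<in> carrier A \<Longrightarrow> app A u z \<cdot> Some b = Some v \<Longrightarrow> app A c z = Some v"
      using s_app[OF u(1) kb(1)] kb(3) by auto
    have "eval_term A (\<lambda>i. if i then b else a) t = Some c"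
      using ka(2) kb(2) u(2) c(2) by (simp add: t_def)
    moreover have "app A c k = Some a"
      using c(3)[OF ks(1)] u(3)[OF ks(1) ka(2)] ka(3)[OF ab(2)] by simp
    moreover have "app A c k' = Some b"
      using c(3)[OF k'(1)] u(3)[OF k'(1)] k'(2)[OF ab(1)] ab(2) by auto
    ultimately show ?thesis using c(1) by blast
  qed
  show ?thesis
  proof (rule that[OF p(1) p0(1) p1(1)])
    fix a assume a: "a \<in> carrier A"
    show "\<exists>pa\<in>carrier A. app A p a = Some pa \<and> (\<forall>b\<in>carrier A. \<exists>c\<in>carrier A.
        app A pa b = Some c \<and> app A p0 c = Some a \<and> app A p1 c = Some b)"
      using p(2)[OF a] pair[OF a] p0(2) p1(2) by blast
  qed
qed

end

section \<open>The order-pca of nonempty subsets\<close>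

lemma carrier_T [simp]: "\<alpha> \<in> carrier (T A) \<longleftrightarrow> \<alpha> \<subseteq> carrier A \<and> \<alpha> \<noteq> {}"
  by (simp add: T_def)

lemma le_T [simp]:
  "(\<alpha>, \<beta>) \<in> le (T A) \<longleftrightarrow> \<alpha> \<in> carrier (T A) \<and> \<beta> \<in> carrier (T A) \<and> \<alpha> \<subseteq> \<beta>"
  by (auto simp: T_def)

lemma app_T:
  "app (T A) \<alpha> \<beta> = (if \<forall>a\<in>\<alpha>. \<forall>b\<in>\<beta>. app A a b \<noteq> None
     then Some {c. \<exists>a\<in>\<alpha>. \<exists>b\<in>\<beta>. app A a b = Some c} else None)"
  by (simp add: T_def)

lemma app_T_eq_Some_iff:
  "app (T A) \<alpha> \<beta> = Some \<delta> \<longleftrightarrow>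
     (\<forall>a\<in>\<alpha>. \<forall>b\<in>\<beta>. \<exists>c\<in>\<delta>. app A a b = Some c) \<and> (\<forall>c\<in>\<delta>. \<exists>a\<in>\<alpha>. \<exists>b\<in>\<beta>. app A a b = Some c)"
  (is "?l \<longleftrightarrow> ?r")
proof
  assume ?l
  then have "\<forall>a\<in>\<alpha>. \<forall>b\<in>\<beta>. \<exists>c. app A a b = Some c"
    and "\<delta> = {c. \<exists>a\<in>\<alpha>. \<exists>b\<in>\<beta>. app A a b = Some c}"
    by (simp_all add: app_T split: if_splits)
  then show ?r by blast
next
  assume r: ?r
  then have "\<delta> = {c. \<exists>a\<in>\<alpha>. \<exists>b\<in>\<beta>. app A a b = Some c}" by fastforce
  moreover have "\<forall>a\<in>\<alpha>. \<forall>b\<in>\<beta>. app A a b \<noteq> None" using r by fastforce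
  ultimately show ?l by (simp add: app_T)
qed

lemma app_T_SomeD:
  assumes "app (T A) \<alpha> \<beta> = Some \<delta>"
  shows "a \<in> \<alpha> \<Longrightarrow> b \<in> \<beta> \<Longrightarrow> \<exists>c\<in>\<delta>. app A a b = Some c"
    and "c \<in> \<delta> \<Longrightarrow> \<exists>a\<in>\<alpha>. \<exists>b\<in>\<beta>. app A a b = Some c"
  using assms unfolding app_T_eq_Some_iff by blast+

text \<open>This reduces realizability in \<open>T A\<close> to a condition on elements. With
  \<open>UNIV\<close> in the place of \<open>\<delta>\<close> it becomes a criterion for mere
  definedness, which is how intermediate products are obtained below.\<close>

lemma app_T_le_iff:
  "(\<exists>e. app (T A) \<alpha> \<beta> = Some e \<and> e \<subseteq> \<delta>) \<longleftrightarrow>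
     (\<forall>a\<in>\<alpha>. \<forall>b\<in>\<beta>. \<exists>c\<in>\<delta>. app A a b = Some c)"
  (is "?l \<longleftrightarrow> ?r")
proof
  assume ?l
  then show ?r unfolding app_T_eq_Some_iff by blast
next
  assume r: ?r
  then have "app (T A) \<alpha> \<beta> = Some {c. \<exists>a\<in>\<alpha>. \<exists>b\<in>\<beta>. app A a b = Some c}"
    by (auto simp: app_T)
  moreover have "{c. \<exists>a\<in>\<alpha>. \<exists>b\<in>\<beta>. app A a b = Some c} \<subseteq> \<delta>" using r by fastforce
  ultimately show ?l by blast
qed

context pca
begin

lemma app_T_closed:
  assumes "\<alpha> \<in> carrier (T A)" "\<beta> \<in> carrier (T A)" "app (T A) \<alpha> \<beta> = Some \<delta>"
  shows "\<delta> \<in> carrier (T A)"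
proof -
  have "\<delta> \<noteq> {}" using assms by (fastforce simp: app_T_eq_Some_iff)
  moreover have "\<delta> \<subseteq> carrier A"
  proof
    fix c assume "c \<in> \<delta>"
    then obtain a b where "a \<in> \<alpha>" "b \<in> \<beta>" "app A a b = Some c"
      using assms(3) by (auto simp: app_T_eq_Some_iff)
    moreover have "\<alpha> \<subseteq> carrier A" "\<beta> \<subseteq> carrier A" using assms(1,2) by simp_all
    ultimately show "c \<in> carrier A" using app_closed by blast
  qed
  ultimately show ?thesis by simp
qed

lemma app_T_leI:
  assumes "\<alpha> \<in> carrier (T A)" "\<beta> \<in> carrier (T A)" "\<delta> \<in> carrier (T A)"
    and "\<And>a b. a \<in> \<alpha> \<Longrightarrow> b \<in> \<beta> \<Longrightarrow> \<exists>c\<in>\<delta>. app A a b = Some c"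
  shows "\<exists>e. app (T A) \<alpha> \<beta> = Some e \<and> (e, \<delta>) \<in> le (T A)"
proof -
  obtain e where e: "app (T A) \<alpha> \<beta> = Some e" "e \<subseteq> \<delta>"
    using assms(4) app_T_le_iff[of A \<alpha> \<beta> \<delta>] by blast
  moreover have "e \<in> carrier (T A)" using app_T_closed[OF assms(1,2) e(1)] .
  ultimately show ?thesis using assms(3) by simp
qed

text \<open>The singletons of \<open>k\<close> and \<open>s\<close> serve as combinators. The law of
  \<open>s\<close> is in general only an inclusion: an element of the left side uses one
  \<open>c\<close> of the third set twice, while the right side also allows two different
  ones.\<close>

lemma order_pca_T: "order_pca (T A)"
proof
  show "c \<in> carrier (T A)" if "a \<in> carrier (T A)" "b \<in> carrier (T A)" "app (T A) a b = Some c" for a b c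
    using app_T_closed that .
  show "partial_order_on (carrier (T A)) (le (T A))"
    by (auto simp: partial_order_on_def preorder_on_def refl_on_def trans_def antisym_def T_def)
  show "\<exists>c'. app (T A) a' b' = Some c' \<and> (c', c) \<in> le (T A)"
    if "a \<in> carrier (T A)" "b \<in> carrier (T A)" "a' \<in> carrier (T A)" "b' \<in> carrier (T A)"
      "app (T A) a b = Some c" "(a', a) \<in> le (T A)" "(b', b) \<in> le (T A)" for a b a' b' c
  proof (rule app_T_leI)
    show "c \<in> carrier (T A)" using app_T_closed that by blast
    show "\<exists>z\<in>c. app A x y = Some z" if "x \<in> a'" "y \<in> b'" for x y
      using \<open>app (T A) a b = Some c\<close> \<open>(a', a) \<in> le (T A)\<close> \<open>(b', b) \<in> le (T A)\<close> that
      unfolding app_T_eq_Some_iff le_T by blast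
  qed (use that in auto)
  obtain k s where KS: "ks_pair k s" by (rule ks_pair_exists)
  note ks = ks_pairD(1,2)[OF KS] and k_app = ks_pairD(3)[OF KS] and s_app = ks_pairD(4)[OF KS]
  have k: "\<exists>d. Some {k} \<cdot>\<^bsub>T A\<^esub> Some \<alpha> \<cdot>\<^bsub>T A\<^esub> Some \<beta> = Some d \<and> (d, \<alpha>) \<in> le (T A)"
    if \<alpha>: "\<alpha> \<in> carrier (T A)" and \<beta>: "\<beta> \<in> carrier (T A)" for \<alpha> \<beta>
  proof -
    obtain \<kappa> where \<kappa>: "app (T A) {k} \<alpha> = Some \<kappa>"
      using k_app \<alpha> app_T_le_iff[of A "{k}" \<alpha> UNIV] by auto blast
    have "\<kappa> \<in> carrier (T A)" using app_T_closed[OF _ \<alpha> \<kappa>] ks by simp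
    then have "\<exists>e. app (T A) \<kappa> \<beta> = Some e \<and> (e, \<alpha>) \<in> le (T A)"
    proof (rule app_T_leI[OF _ \<beta> \<alpha>])
      fix f b assume "f \<in> \<kappa>" "b \<in> \<beta>"
      then obtain a where "a \<in> \<alpha>" "app A k a = Some f"
        using app_T_SomeD(2)[OF \<kappa> \<open>f \<in> \<kappa>\<close>] by auto
      moreover have "a \<in> carrier A" "b \<in> carrier A"
        using \<open>a \<in> \<alpha>\<close> \<open>b \<in> \<beta>\<close> \<alpha> \<beta> by auto
      ultimately show "\<exists>c\<in>\<alpha>. app A f b = Some c"
        using k_app by fastforce
    qed
    then show ?thesis using \<kappa> by simp
  qed
  have s: "Some {s} \<cdot>\<^bsub>T A\<^esub> Some \<alpha> \<cdot>\<^bsub>T A\<^esub> Some \<beta> \<noteq> None \<and>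
         (\<forall>e. Some \<alpha> \<cdot>\<^bsub>T A\<^esub> Some \<epsilon> \<cdot>\<^bsub>T A\<^esub> (Some \<beta> \<cdot>\<^bsub>T A\<^esub> Some \<epsilon>) = Some e \<longrightarrow>
            (\<exists>d. Some {s} \<cdot>\<^bsub>T A\<^esub> Some \<alpha> \<cdot>\<^bsub>T A\<^esub> Some \<beta> \<cdot>\<^bsub>T A\<^esub> Some \<epsilon> = Some d \<and> (d, e) \<in> le (T A)))"
    if \<alpha>: "\<alpha> \<in> carrier (T A)" and \<beta>: "\<beta> \<in> carrier (T A)" and \<epsilon>: "\<epsilon> \<in> carrier (T A)" for \<alpha> \<beta> \<epsilon>
  proof -
    \<comment> \<open>The second argument is a dummy: since \<open>s a a\<close> is defined, so is
      \<open>s a\<close>.\<close>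
    have "\<exists>c. app A s a = Some c" if "a \<in> \<alpha>" for a
      using s_app[of a a] that \<alpha> by (auto simp: term_app_eq_Some_iff)
    then obtain \<sigma> where \<sigma>: "app (T A) {s} \<alpha> = Some \<sigma>"
      using app_T_le_iff[of A "{s}" \<alpha> UNIV] by auto
    have \<sigma>': "\<sigma> \<in> carrier (T A)" using app_T_closed[OF _ \<alpha> \<sigma>] ks by simp
    have "\<exists>c. app A f b = Some c" if f: "f \<in> \<sigma>" and b: "b \<in> \<beta>" for f b
    proof -
      obtain a where a: "a \<in> \<alpha>" "app A s a = Some f"
        using app_T_SomeD(2)[OF \<sigma> f] by auto
      then have "a \<in> carrier A" "b \<in> carrier A" using \<alpha> \<beta> b by auto
      then obtain h where "Some s \<cdot> Some a \<cdot> Some b = Some h" using s_app by blast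
      then show ?thesis using a(2) by auto
    qed
    then obtain \<tau> where \<tau>: "app (T A) \<sigma> \<beta> = Some \<tau>"
      using app_T_le_iff[of A \<sigma> \<beta> UNIV] by auto
    have \<tau>': "\<tau> \<in> carrier (T A)" using app_T_closed[OF \<sigma>' \<beta> \<tau>] .
    have "\<exists>d. app (T A) \<tau> \<epsilon> = Some d \<and> (d, e) \<in> le (T A)"
      if e: "Some \<alpha> \<cdot>\<^bsub>T A\<^esub> Some \<epsilon> \<cdot>\<^bsub>T A\<^esub> (Some \<beta> \<cdot>\<^bsub>T A\<^esub> Some \<epsilon>) = Some e" for e
    proof -
      obtain \<mu> \<nu> where \<mu>: "app (T A) \<alpha> \<epsilon> = Some \<mu>" and \<nu>: "app (T A) \<beta> \<epsilon> = Some \<nu>"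
        and \<mu>\<nu>: "app (T A) \<mu> \<nu> = Some e"
        using e by (auto simp: term_app_eq_Some_iff)
      have "e \<in> carrier (T A)"
        using app_T_closed \<alpha> \<beta> \<epsilon> \<mu> \<nu> \<mu>\<nu> by blast
      moreover have "\<exists>d\<in>e. app A h c = Some d" if h: "h \<in> \<tau>" and c: "c \<in> \<epsilon>" for h c
      proof -
        obtain f b where f: "f \<in> \<sigma>" "b \<in> \<beta>" "app A f b = Some h"
          using app_T_SomeD(2)[OF \<tau> h] by auto
        obtain a where a: "a \<in> \<alpha>" "app A s a = Some f"
          using app_T_SomeD(2)[OF \<sigma> f(1)] by auto
        obtain m where m: "m \<in> \<mu>" "app A a c = Some m"
          using app_T_SomeD(1)[OF \<mu> a(1) c] by auto
        obtain n where n: "n \<in> \<nu>" "app A b c = Some n"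
          using app_T_SomeD(1)[OF \<nu> f(2) c] by auto
        obtain d where d: "d \<in> e" "app A m n = Some d"
          using app_T_SomeD(1)[OF \<mu>\<nu> m(1) n(1)] by auto
        have "a \<in> carrier A" "b \<in> carrier A" "c \<in> carrier A" using \<alpha> \<beta> \<epsilon> a f c by auto
        then have "app A h c = Some d"
          using s_app[of a b] a(2) f(3) m(2) n(2) d(2) by auto
        then show ?thesis using d(1) by blast
      qed
      ultimately show ?thesis using app_T_leI \<tau>' \<epsilon> by blast
    qed
    then show ?thesis using \<sigma> \<tau> by simp
  qed
  show "\<exists>k\<in>carrier (T A). \<exists>s\<in>carrier (T A). \<forall>a\<in>carrier (T A). \<forall>b\<in>carrier (T A). \<forall>c\<in>carrier (T A).
         (\<exists>d. Some k \<cdot>\<^bsub>T A\<^esub> Some a \<cdot>\<^bsub>T A\<^esub> Some b = Some d \<and> (d, a) \<in> le (T A)) \<and>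
         Some s \<cdot>\<^bsub>T A\<^esub> Some a \<cdot>\<^bsub>T A\<^esub> Some b \<noteq> None \<and>
         (\<forall>e. Some a \<cdot>\<^bsub>T A\<^esub> Some c \<cdot>\<^bsub>T A\<^esub> (Some b \<cdot>\<^bsub>T A\<^esub> Some c) = Some e \<longrightarrow>
            (\<exists>d. Some s \<cdot>\<^bsub>T A\<^esub> Some a \<cdot>\<^bsub>T A\<^esub> Some b \<cdot>\<^bsub>T A\<^esub> Some c = Some d \<and> (d, e) \<in> le (T A)))"
    by (rule bexI[of _ "{k}"], rule bexI[of _ "{s}"]) (use k s ks in auto)
qed

end

section \<open>Tracking along a morphism, and its extension to nonempty subsets\<close>

context applicative_morphism
begin

lemma carrier_value: "a \<in> carrier A \<Longrightarrow> y \<in> \<gamma> a \<Longrightarrow> y \<in> carrier B"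
  using nonempty_subset by blast

text \<open>Fix a single \<open>q\<close> in \<open>\<gamma> f\<close>. The element \<open>e\<close>
  is the abstraction of \<open>y\<close> from \<open>r q y\<close>, where \<open>r\<close> realizes
  \<open>\<gamma>\<close>, so it imitates on realizers what \<open>f\<close> does in
  \<open>A\<close>.\<close>

lemma track:
  assumes f: "f \<in> carrier A"
  obtains e where "e \<in> carrier B"
    and "\<And>a d y. a \<in> carrier A \<Longrightarrow> app A f a = Some d \<Longrightarrow> y \<in> \<gamma> a \<Longrightarrow> \<exists>z\<in>\<gamma> d. app B e y = Some z"
proof -
  obtain r where r: "r \<in> carrier B"
    "\<And>a a' d b b'. a \<in> carrier A \<Longrightarrow> a' \<in> carrier A \<Longrightarrow> app A a a' = Some d \<Longrightarrow>
       b \<in> \<gamma> a \<Longrightarrow> b' \<in> \<gamma> a' \<Longrightarrow>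
       \<exists>e. Some r \<cdot>\<^bsub>B\<^esub> Some b \<cdot>\<^bsub>B\<^esub> Some b' = Some e \<and> e \<in> \<gamma> d"
    using realizer by blast
  obtain q where q: "q \<in> \<gamma> f" "q \<in> carrier B"
    using nonempty_subset[OF f] by blast
  obtain e where "e \<in> carrier B"
    "\<And>x v. x \<in> carrier B \<Longrightarrow> Some r \<cdot>\<^bsub>B\<^esub> Some q \<cdot>\<^bsub>B\<^esub> Some x = Some v \<Longrightarrow> app B e x = Some v"
    using B.unary_completeness[of "App (App (Const r) (Const q)) (Var ())"] r(1) q(2) by auto
  then show ?thesis
    using that r(2)[OF f _ _ q(1)] carrier_value by blast
qed

text \<open>The element \<open>e\<close> decodes a realizer of a pair, applies \<open>m\<close> and \<open>n\<close> to the two components, and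
  applies the first result to the second.\<close>

lemma decode_apply:
  assumes m: "m \<in> carrier B" and n: "n \<in> carrier B"
  obtains p e where "p \<in> carrier A" and "e \<in> carrier B"
    and "\<And>a. a \<in> carrier A \<Longrightarrow> \<exists>pa\<in>carrier A. app A p a = Some pa \<and>
      (\<forall>a'\<in>carrier A. \<exists>c\<in>carrier A. app A pa a' = Some c \<and>
         (\<forall>y\<in>\<gamma> c. \<exists>x\<in>\<gamma> a. \<exists>x'\<in>\<gamma> a'. \<forall>v. app B m x \<cdot>\<^bsub>B\<^esub> app B n x' = Some v \<longrightarrow> app B e y = Some v))"
proof -
  obtain p p0 p1 where p: "p \<in> carrier A" "p0 \<in> carrier A" "p1 \<in> carrier A"
    and pair: "\<And>a. a \<in> carrier A \<Longrightarrow> \<exists>pa\<in>carrier A. app A p a = Some pa \<and>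
      (\<forall>b\<in>carrier A. \<exists>c\<in>carrier A. app A pa b = Some c \<and> app A p0 c = Some a \<and> app A p1 c = Some b)"
    using A.pairing by blast
  obtain e0 where e0: "e0 \<in> carrier B"
    "\<And>a d y. a \<in> carrier A \<Longrightarrow> app A p0 a = Some d \<Longrightarrow> y \<in> \<gamma> a \<Longrightarrow> \<exists>z\<in>\<gamma> d. app B e0 y = Some z"
    using track[OF p(2)] by blast
  obtain e1 where e1: "e1 \<in> carrier B"
    "\<And>a d y. a \<in> carrier A \<Longrightarrow> app A p1 a = Some d \<Longrightarrow> y \<in> \<gamma> a \<Longrightarrow> \<exists>z\<in>\<gamma> d. app B e1 y = Some z"
    using track[OF p(3)] by blast
  obtain e where e: "e \<in> carrier B"
    "\<And>y v. y \<in> carrier B \<Longrightarrow>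
      Some m \<cdot>\<^bsub>B\<^esub> app B e0 y \<cdot>\<^bsub>B\<^esub> (Some n \<cdot>\<^bsub>B\<^esub> app B e1 y) = Some v \<Longrightarrow> app B e y = Some v"
    using B.unary_completeness[of "App (App (Const m) (App (Const e0) (Var ())))
      (App (Const n) (App (Const e1) (Var ())))"] m n e0(1) e1(1) by auto
  have *: "\<exists>x\<in>\<gamma> a. \<exists>x'\<in>\<gamma> a'. \<forall>v. app B m x \<cdot>\<^bsub>B\<^esub> app B n x' = Some v \<longrightarrow> app B e y = Some v"
    if c: "c \<in> carrier A" "app A p0 c = Some a" "app A p1 c = Some a'" "y \<in> \<gamma> c" for a a' c y
  proof -
    obtain x where x: "x \<in> \<gamma> a" "app B e0 y = Some x" using e0(2) c by blast
    obtain x' where x': "x' \<in> \<gamma> a'" "app B e1 y = Some x'" using e1(2) c by blast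
    show ?thesis
      using e(2)[OF carrier_value[OF c(1,4)]] x x' by auto
  qed
  show ?thesis
  proof (rule that[OF p(1) e(1)])
    fix a assume "a \<in> carrier A"
    then obtain pa where pa: "pa \<in> carrier A" "app A p a = Some pa"
      "\<And>b. b \<in> carrier A \<Longrightarrow>
        \<exists>c\<in>carrier A. app A pa b = Some c \<and> app A p0 c = Some a \<and> app A p1 c = Some b"
      using pair by blast
    have step: "\<exists>c\<in>carrier A. app A pa a' = Some c \<and> (\<forall>y\<in>\<gamma> c. \<exists>x\<in>\<gamma> a. \<exists>x'\<in>\<gamma> a'.
        \<forall>v. app B m x \<cdot>\<^bsub>B\<^esub> app B n x' = Some v \<longrightarrow> app B e y = Some v)"
      if a': "a' \<in> carrier A" for a'
    proof -
      obtain c where c: "c \<in> carrier A" "app A pa a' = Some c"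
        "app A p0 c = Some a" "app A p1 c = Some a'"
        using pa(3)[OF a'] by blast
      show ?thesis
        by (rule bexI[OF _ c(1)]) (intro conjI ballI c(2) *[OF c(1,3,4)])
    qed
    show "\<exists>pa\<in>carrier A. app A p a = Some pa \<and> (\<forall>a'\<in>carrier A. \<exists>c\<in>carrier A.
        app A pa a' = Some c \<and> (\<forall>y\<in>\<gamma> c. \<exists>x\<in>\<gamma> a. \<exists>x'\<in>\<gamma> a'.
          \<forall>v. app B m x \<cdot>\<^bsub>B\<^esub> app B n x' = Some v \<longrightarrow> app B e y = Some v))"
      by (rule bexI[OF _ pa(1)]) (intro conjI[OF pa(2)] ballI step)
  qed
qed

text \<open>Singletons of elements of \<open>B\<close> act as realizers. A realizer of
  \<open>\<gamma>\<close> works elementwise on unions, and since larger index sets give larger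
  unions, the identity of \<open>B\<close> realizes preservation of the order.\<close>

lemma order_morphism_tilde: "order_morphism (T A) (T B) (tilde \<gamma>)"
proof -
  interpret TA: order_pca "T A" by (rule A.order_pca_T)
  interpret TB: order_pca "T B" by (rule B.order_pca_T)
  have closed: "tilde \<gamma> \<alpha> \<in> carrier (T B)" if "\<alpha> \<in> carrier (T A)" for \<alpha>
    using that nonempty_subset by (fastforce simp: tilde_def)
  obtain r where r: "r \<in> carrier B"
    "\<And>a a' d b b'. a \<in> carrier A \<Longrightarrow> a' \<in> carrier A \<Longrightarrow> app A a a' = Some d \<Longrightarrow>
       b \<in> \<gamma> a \<Longrightarrow> b' \<in> \<gamma> a' \<Longrightarrow>
       \<exists>e. Some r \<cdot>\<^bsub>B\<^esub> Some b \<cdot>\<^bsub>B\<^esub> Some b' = Some e \<and> e \<in> \<gamma> d"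
    using realizer by blast
  \<comment> \<open>The curried form of \<open>r\<close> has a value \<open>f x\<close> for every
    \<open>x\<close>, so the product of \<open>{f}\<close> with
    \<open>tilde \<gamma> \<alpha>\<close> can be formed before the second argument is
    considered.\<close>
  obtain f where f: "f \<in> carrier B" "\<And>x. x \<in> carrier B \<Longrightarrow> \<exists>g\<in>carrier B. app B f x = Some g \<and>
      (\<forall>y\<in>carrier B. \<forall>v. Some r \<cdot>\<^bsub>B\<^esub> Some x \<cdot>\<^bsub>B\<^esub> Some y = Some v \<longrightarrow> app B g y = Some v)"
    using B.binary_completeness[of "App (App (Const r) (Var False)) (Var True)"] r(1) by auto
  obtain i where i: "i \<in> carrier B" "\<And>b. b \<in> carrier B \<Longrightarrow> app B i b = Some b"
    using B.identity_realizer by blast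
  show ?thesis
  proof
    show "tilde \<gamma> a \<in> carrier (T B)" if "a \<in> carrier (T A)" for a
      using closed that .
    have "\<exists>e. Some {f} \<cdot>\<^bsub>T B\<^esub> Some (tilde \<gamma> \<alpha>) \<cdot>\<^bsub>T B\<^esub> Some (tilde \<gamma> \<beta>) = Some e \<and>
        (e, tilde \<gamma> \<delta>) \<in> le (T B)"
      if \<alpha>: "\<alpha> \<in> carrier (T A)" and \<beta>: "\<beta> \<in> carrier (T A)" and \<delta>: "app (T A) \<alpha> \<beta> = Some \<delta>" for \<alpha> \<beta> \<delta>
    proof -
      obtain \<phi> where \<phi>: "app (T B) {f} (tilde \<gamma> \<alpha>) = Some \<phi>"
        using f(2) closed[OF \<alpha>] app_T_le_iff[of B "{f}" "tilde \<gamma> \<alpha>" UNIV] by auto blast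
      have "\<phi> \<in> carrier (T B)" using B.app_T_closed[OF _ closed[OF \<alpha>] \<phi>] f(1) by simp
      then have "\<exists>e. app (T B) \<phi> (tilde \<gamma> \<beta>) = Some e \<and> (e, tilde \<gamma> \<delta>) \<in> le (T B)"
      proof (rule B.app_T_leI)
        show "tilde \<gamma> \<beta> \<in> carrier (T B)" using closed[OF \<beta>] .
        show "tilde \<gamma> \<delta> \<in> carrier (T B)" using closed[OF A.app_T_closed[OF \<alpha> \<beta> \<delta>]] .
        fix g y assume g: "g \<in> \<phi>" and y: "y \<in> tilde \<gamma> \<beta>"
        obtain a x where a: "a \<in> \<alpha>" "x \<in> \<gamma> a" "app B f x = Some g"
          using app_T_SomeD(2)[OF \<phi> g] by (auto simp: tilde_def)
        obtain b where b: "b \<in> \<beta>" "y \<in> \<gamma> b" using y by (auto simp: tilde_def)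
        obtain d where d: "d \<in> \<delta>" "app A a b = Some d"
          using app_T_SomeD(1)[OF \<delta> a(1) b(1)] by auto
        have ab: "a \<in> carrier A" "b \<in> carrier A" using \<alpha> \<beta> a b by auto
        obtain e where e: "Some r \<cdot>\<^bsub>B\<^esub> Some x \<cdot>\<^bsub>B\<^esub> Some y = Some e" "e \<in> \<gamma> d"
          using r(2)[OF ab d(2) a(2) b(2)] by blast
        have "app B g y = Some e"
          using f(2)[of x] carrier_value ab a b e(1) by auto
        then show "\<exists>c\<in>tilde \<gamma> \<delta>. app B g y = Some c"
          using e(2) d(1) by (auto simp: tilde_def)
      qed
      then show ?thesis using \<phi> by simp
    qed
    then show "\<exists>r\<in>carrier (T B). \<forall>a\<in>carrier (T A). \<forall>a'\<in>carrier (T A). \<forall>d. app (T A) a a' = Some d \<longrightarrow>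
         (\<exists>e. Some r \<cdot>\<^bsub>T B\<^esub> Some (tilde \<gamma> a) \<cdot>\<^bsub>T B\<^esub> Some (tilde \<gamma> a') = Some e \<and>
              (e, tilde \<gamma> d) \<in> le (T B))"
      using f(1) by (intro bexI[of _ "{f}"]) auto
    have "\<exists>e. app (T B) {i} (tilde \<gamma> \<alpha>) = Some e \<and> (e, tilde \<gamma> \<beta>) \<in> le (T B)"
      if "\<alpha> \<in> carrier (T A)" "\<beta> \<in> carrier (T A)" "\<alpha> \<subseteq> \<beta>" for \<alpha> \<beta>
    proof (rule B.app_T_leI)
      fix x y assume "x \<in> {i}" and y: "y \<in> tilde \<gamma> \<alpha>"
      moreover have "y \<in> tilde \<gamma> \<beta>" using y that(3) by (auto simp: tilde_def)
      moreover have "y \<in> carrier B" using y closed[OF that(1)] by auto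
      ultimately show "\<exists>c\<in>tilde \<gamma> \<beta>. app B x y = Some c" using i(2) by auto
    qed (use closed that i(1) in auto)
    then show "\<exists>u\<in>carrier (T B). \<forall>a\<in>carrier (T A). \<forall>a'\<in>carrier (T A). (a, a') \<in> le (T A) \<longrightarrow>
         (\<exists>e. app (T B) u (tilde \<gamma> a) = Some e \<and> (e, tilde \<gamma> a') \<in> le (T B))"
      using i(1) by (intro bexI[of _ "{i}"]) auto
  qed
qed

section \<open>The cycle of implications between density, right adjoint and section\<close>

lemma computationally_dense_imp_right_adjoint:
  assumes "computationally_dense A B \<gamma>"
  shows "\<exists>g. right_adjoint (T A) (T B) (tilde \<gamma>) g"
proof -
  interpret tilde: order_morphism "T A" "T B" "tilde \<gamma>" by (rule order_morphism_tilde)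
  obtain m where m: "m \<in> carrier B"
    and dense: "\<And>b. b \<in> carrier B \<Longrightarrow> \<exists>a\<in>carrier A. \<forall>a'\<in>carrier A.
        elt_set_defined B b (\<gamma> a') \<longrightarrow>
        (\<exists>d. app A a a' = Some d \<and> elt_set_defined B m (\<gamma> d) \<and>
             elt_set_app B m (\<gamma> d) \<subseteq> elt_set_app B b (\<gamma> a'))"
    using assms unfolding computationally_dense_def by blast
  \<comment> \<open>This is the largest set of elements whose realizers \<open>m\<close> sends into
    \<open>\<beta>\<close>. Hence \<open>m\<close> itself realizes the counit, and \<open>g\<close>
    preserves inclusions.\<close>
  define g where "g \<beta> = {a \<in> carrier A. \<forall>y\<in>\<gamma> a. \<exists>c\<in>\<beta>. app B m y = Some c}" for \<beta>
  \<comment> \<open>Density in the form of transposition along the adjunction: if \<open>b\<close>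
    sends \<open>\<gamma> a'\<close> into \<open>\<beta>\<close>, then \<open>a\<close> sends
    \<open>a'\<close> into \<open>g \<beta>\<close>. One \<open>a\<close> serves all
    \<open>a'\<close> and all \<open>\<beta>\<close>, and this uniformity makes it usable as a
    realizer.\<close>
  have pull: "\<exists>a\<in>carrier A. \<forall>a'\<in>carrier A. \<forall>\<beta>. (\<forall>y\<in>\<gamma> a'. \<exists>c\<in>\<beta>. app B b y = Some c) \<longrightarrow>
      (\<exists>d\<in>g \<beta>. app A a a' = Some d)" if b: "b \<in> carrier B" for b
  proof -
    obtain a where a: "a \<in> carrier A"
      "\<And>a'. a' \<in> carrier A \<Longrightarrow> elt_set_defined B b (\<gamma> a') \<Longrightarrow>
        \<exists>d. app A a a' = Some d \<and> elt_set_defined B m (\<gamma> d) \<and>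
             elt_set_app B m (\<gamma> d) \<subseteq> elt_set_app B b (\<gamma> a')"
      using dense[OF b] by blast
    have "\<exists>d\<in>g \<beta>. app A a a' = Some d"
      if a': "a' \<in> carrier A" and \<beta>: "\<forall>y\<in>\<gamma> a'. \<exists>c\<in>\<beta>. app B b y = Some c" for a' \<beta>
    proof -
      have "elt_set_defined B b (\<gamma> a')" and sub: "elt_set_app B b (\<gamma> a') \<subseteq> \<beta>"
        using \<beta> by (fastforce simp: elt_set_defined_def elt_set_app_def)+
      then obtain d where d: "app A a a' = Some d" "elt_set_defined B m (\<gamma> d)"
        "elt_set_app B m (\<gamma> d) \<subseteq> \<beta>"
        using a(2)[OF a'] by blast
      then have "d \<in> g \<beta>"
        using A.app_closed[OF a(1) a' d(1)]
        by (fastforce simp: g_def elt_set_defined_def elt_set_app_def)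
      then show ?thesis using d(1) by blast
    qed
    then show ?thesis using a(1) by blast
  qed
  have closed: "g \<beta> \<in> carrier (T A)" if "\<beta> \<in> carrier (T B)" for \<beta>
  proof -
    obtain b where b: "b \<in> \<beta>" "b \<in> carrier B" using \<open>\<beta> \<in> carrier (T B)\<close> by auto
    \<comment> \<open>Transposing the constant map with value \<open>b\<close> in
      \<open>\<beta>\<close> gives an element of \<open>A\<close> that sends every \<open>a'\<close>
      into \<open>g \<beta>\<close>. The identity of \<open>A\<close> supplies such an
      \<open>a'\<close>.\<close>
    obtain f where f: "f \<in> carrier B" "\<And>y. y \<in> carrier B \<Longrightarrow> app B f y = Some b"
      using B.constant_realizer[OF b(2)] by blast
    have "\<forall>y\<in>\<gamma> f'. \<exists>c\<in>\<beta>. app B f y = Some c" if "f' \<in> carrier A" for f'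
      using f(2) b(1) carrier_value[OF that] by blast
    moreover obtain a' where "a' \<in> carrier A" using A.identity_realizer by blast
    ultimately have "g \<beta> \<noteq> {}" using pull[OF f(1)] by blast
    then show ?thesis by (auto simp: g_def)
  qed
  obtain iA where iA: "iA \<in> carrier A" "\<And>a. a \<in> carrier A \<Longrightarrow> app A iA a = Some a"
    using A.identity_realizer by blast
  obtain iB where iB: "iB \<in> carrier B" "\<And>b. b \<in> carrier B \<Longrightarrow> app B iB b = Some b"
    using B.identity_realizer by blast
  have "order_morphism (T B) (T A) g"
  proof
    show "g \<beta> \<in> carrier (T A)" if "\<beta> \<in> carrier (T B)" for \<beta>
      using closed that .
    obtain p e where p: "p \<in> carrier A" and e: "e \<in> carrier B"
      and pe: "\<And>a. a \<in> carrier A \<Longrightarrow> \<exists>pa\<in>carrier A. app A p a = Some pa \<and>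
        (\<forall>a'\<in>carrier A. \<exists>c\<in>carrier A. app A pa a' = Some c \<and>
          (\<forall>y\<in>\<gamma> c. \<exists>x\<in>\<gamma> a. \<exists>x'\<in>\<gamma> a'. \<forall>v. app B m x \<cdot>\<^bsub>B\<^esub> app B m x' = Some v \<longrightarrow> app B e y = Some v))"
      using decode_apply[OF m m] by blast
    \<comment> \<open>If \<open>c\<close> codes a pair from \<open>g \<beta>\<close> and
      \<open>g \<beta>'\<close>, then \<open>m\<close> sends realizers of the components into
      \<open>\<beta>\<close> and \<open>\<beta>'\<close>. So \<open>e\<close> sends
      \<open>\<gamma> c\<close> into the product of \<open>\<beta>\<close> and
      \<open>\<beta>'\<close>, and its transpose \<open>a0\<close> sends \<open>c\<close> into
      \<open>g\<close> of that product.\<close>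
    obtain a0 where a0: "a0 \<in> carrier A"
      "\<And>a' \<beta>. a' \<in> carrier A \<Longrightarrow> (\<And>y. y \<in> \<gamma> a' \<Longrightarrow> \<exists>c\<in>\<beta>. app B e y = Some c) \<Longrightarrow>
        \<exists>d\<in>g \<beta>. app A a0 a' = Some d"
      using pull[OF e] by blast
    \<comment> \<open>The realizer of \<open>g\<close> forms the code of the pair with
      \<open>p\<close> and then applies \<open>a0\<close>.\<close>
    obtain r where r: "r \<in> carrier A" "\<And>a. a \<in> carrier A \<Longrightarrow> \<exists>ra\<in>carrier A. app A r a = Some ra \<and>
        (\<forall>a'\<in>carrier A. \<forall>v. Some a0 \<cdot>\<^bsub>A\<^esub> (Some p \<cdot>\<^bsub>A\<^esub> Some a \<cdot>\<^bsub>A\<^esub> Some a') = Some v \<longrightarrow> app A ra a' = Some v)"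
      using A.binary_completeness[of "App (Const a0) (App (App (Const p) (Var False)) (Var True))"]
        a0(1) p by auto
    have "\<exists>h. Some {r} \<cdot>\<^bsub>T A\<^esub> Some (g \<beta>) \<cdot>\<^bsub>T A\<^esub> Some (g \<beta>') = Some h \<and> (h, g \<delta>) \<in> le (T A)"
      if \<beta>: "\<beta> \<in> carrier (T B)" and \<beta>': "\<beta>' \<in> carrier (T B)" and \<delta>: "app (T B) \<beta> \<beta>' = Some \<delta>" for \<beta> \<beta>' \<delta>
    proof -
      obtain \<rho> where \<rho>: "app (T A) {r} (g \<beta>) = Some \<rho>"
        using r(2) closed[OF \<beta>] app_T_le_iff[of A "{r}" "g \<beta>" UNIV] by auto blast
      have "\<rho> \<in> carrier (T A)" using A.app_T_closed[OF _ closed[OF \<beta>] \<rho>] r(1) by simp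
      then have "\<exists>h. app (T A) \<rho> (g \<beta>') = Some h \<and> (h, g \<delta>) \<in> le (T A)"
      proof (rule A.app_T_leI)
        show "g \<beta>' \<in> carrier (T A)" using closed[OF \<beta>'] .
        show "g \<delta> \<in> carrier (T A)" using closed[OF B.app_T_closed[OF \<beta> \<beta>' \<delta>]] .
        fix ra a' assume ra: "ra \<in> \<rho>" and a': "a' \<in> g \<beta>'"
        obtain a where a: "a \<in> g \<beta>" "app A r a = Some ra"
          using app_T_SomeD(2)[OF \<rho> ra] by auto
        have aA: "a \<in> carrier A" "a' \<in> carrier A" using a a' by (auto simp: g_def)
        obtain pa c where c: "app A p a = Some pa" "app A pa a' = Some c" "c \<in> carrier A"
          "\<And>y. y \<in> \<gamma> c \<Longrightarrow> \<exists>x\<in>\<gamma> a. \<exists>x'\<in>\<gamma> a'. \<forall>v. app B m x \<cdot>\<^bsub>B\<^esub> app B m x' = Some v \<longrightarrow> app B e y = Some v"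
          using pe[OF aA(1)] aA(2) by blast
        have "\<exists>v\<in>\<delta>. app B e y = Some v" if y: "y \<in> \<gamma> c" for y
        proof -
          obtain x x' where x: "x \<in> \<gamma> a" "x' \<in> \<gamma> a'"
            "\<And>v. app B m x \<cdot>\<^bsub>B\<^esub> app B m x' = Some v \<Longrightarrow> app B e y = Some v"
            using c(4)[OF y] by blast
          obtain b where b: "b \<in> \<beta>" "app B m x = Some b" using a(1) x(1) by (auto simp: g_def)
          obtain b' where b': "b' \<in> \<beta>'" "app B m x' = Some b'" using a' x(2) by (auto simp: g_def)
          obtain v where "v \<in> \<delta>" "app B b b' = Some v"
            using app_T_SomeD(1)[OF \<delta> b(1) b'(1)] by auto
          then show ?thesis using x(3) b(2) b'(2) by auto
        qed
        then obtain d where "d \<in> g \<delta>" "app A a0 c = Some d"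
          using a0(2)[OF c(3)] by blast
        then show "\<exists>d\<in>g \<delta>. app A ra a' = Some d"
          using r(2)[OF aA(1)] a(2) aA(2) c(1,2) by auto
      qed
      then show ?thesis using \<rho> by simp
    qed
    then show "\<exists>r\<in>carrier (T A). \<forall>a\<in>carrier (T B). \<forall>a'\<in>carrier (T B). \<forall>d. app (T B) a a' = Some d \<longrightarrow>
         (\<exists>e. Some r \<cdot>\<^bsub>T A\<^esub> Some (g a) \<cdot>\<^bsub>T A\<^esub> Some (g a') = Some e \<and> (e, g d) \<in> le (T A))"
      using r(1) by (intro bexI[of _ "{r}"]) auto
    have "\<exists>e. app (T A) {iA} (g \<beta>) = Some e \<and> (e, g \<beta>') \<in> le (T A)"
      if "\<beta> \<in> carrier (T B)" "\<beta>' \<in> carrier (T B)" "\<beta> \<subseteq> \<beta>'" for \<beta> \<beta>'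
    proof (rule A.app_T_leI)
      fix i a assume "i \<in> {iA}" "a \<in> g \<beta>"
      then show "\<exists>c\<in>g \<beta>'. app A i a = Some c"
        using iA(2) that(3) by (fastforce simp: g_def)
    qed (use closed that iA(1) in auto)
    then show "\<exists>u\<in>carrier (T A). \<forall>a\<in>carrier (T B). \<forall>a'\<in>carrier (T B). (a, a') \<in> le (T B) \<longrightarrow>
         (\<exists>e. app (T A) u (g a) = Some e \<and> (e, g a') \<in> le (T A))"
      using iA(1) by (intro bexI[of _ "{iA}"]) auto
  qed
  moreover have "order_morphism_le (T A) (T A) id (g \<circ> tilde \<gamma>)"
  proof -
    \<comment> \<open>The unit is the transpose of the identity of \<open>B\<close>, which sends
      \<open>\<gamma> a\<close> into \<open>tilde \<gamma> \<alpha>\<close> for each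
      \<open>a\<close> in \<open>\<alpha>\<close>.\<close>
    obtain a0 where a0: "a0 \<in> carrier A"
      "\<And>a' \<beta>. a' \<in> carrier A \<Longrightarrow> (\<And>y. y \<in> \<gamma> a' \<Longrightarrow> \<exists>c\<in>\<beta>. app B iB y = Some c) \<Longrightarrow>
        \<exists>d\<in>g \<beta>. app A a0 a' = Some d"
      using pull[OF iB(1)] by blast
    have "\<exists>e. app (T A) {a0} \<alpha> = Some e \<and> (e, g (tilde \<gamma> \<alpha>)) \<in> le (T A)"
      if \<alpha>: "\<alpha> \<in> carrier (T A)" for \<alpha>
    proof (rule A.app_T_leI)
      fix x a assume x: "x \<in> {a0}" and a: "a \<in> \<alpha>"
      have "\<exists>c\<in>tilde \<gamma> \<alpha>. app B iB y = Some c" if "y \<in> \<gamma> a" for y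
        using iB(2) carrier_value that a \<alpha> by (auto simp: tilde_def)
      then show "\<exists>c\<in>g (tilde \<gamma> \<alpha>). app A x a = Some c"
        using a0(2) x a \<alpha> by auto
    qed (use \<alpha> a0(1) closed[OF tilde.maps[OF \<alpha>]] in auto)
    then show ?thesis
      unfolding order_morphism_le_def using a0(1) by (intro bexI[of _ "{a0}"]) auto
  qed
  moreover have "order_morphism_le (T B) (T B) (tilde \<gamma> \<circ> g) id"
  proof -
    have "\<exists>e. app (T B) {m} (tilde \<gamma> (g \<beta>)) = Some e \<and> (e, \<beta>) \<in> le (T B)"
      if \<beta>: "\<beta> \<in> carrier (T B)" for \<beta>
    proof (rule B.app_T_leI)
      fix x y assume "x \<in> {m}" "y \<in> tilde \<gamma> (g \<beta>)"
      then show "\<exists>c\<in>\<beta>. app B x y = Some c" by (auto simp: tilde_def g_def)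
    qed (use \<beta> m tilde.maps[OF closed[OF \<beta>]] in auto)
    then show ?thesis
      unfolding order_morphism_le_def using m by (intro bexI[of _ "{m}"]) auto
  qed
  ultimately show ?thesis
    unfolding right_adjoint_def using order_morphism_tilde by blast
qed

text \<open>If \<open>b b'\<close> is defined, the product of the singletons \<open>{b}\<close> and
  \<open>{b'}\<close> is the singleton of \<open>b b'\<close>, so the realizing set of
  \<open>g\<close> restricts to singletons. Products in \<open>T A\<close> range over all elements
  of both factors, hence any single element of a realizing set realizes. For the counit, a value in
  \<open>{b}\<close> can only be \<open>b\<close>.\<close>

lemma right_adjoint_imp_section:
  assumes "right_adjoint (T A) (T B) (tilde \<gamma>) g"
  shows "\<exists>\<delta>. applicative_morphism B A \<delta> \<and> morphism_le B B (morphism_comp \<gamma> \<delta>) morphism_id"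
proof (intro exI conjI)
  interpret g: order_morphism "T B" "T A" g
    using assms by (simp add: right_adjoint_def)
  show "applicative_morphism B A (\<lambda>b. g {b})"
  proof
    show "g {b} \<noteq> {} \<and> g {b} \<subseteq> carrier A" if "b \<in> carrier B" for b
      using g.maps[of "{b}"] that by simp
    obtain R where R: "R \<in> carrier (T A)"
      "\<And>\<beta> \<beta>' \<delta>. \<beta> \<in> carrier (T B) \<Longrightarrow> \<beta>' \<in> carrier (T B) \<Longrightarrow> app (T B) \<beta> \<beta>' = Some \<delta> \<Longrightarrow>
        \<exists>e. Some R \<cdot>\<^bsub>T A\<^esub> Some (g \<beta>) \<cdot>\<^bsub>T A\<^esub> Some (g \<beta>') = Some e \<and> (e, g \<delta>) \<in> le (T A)"
      using g.realizer by blast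
    obtain r where r: "r \<in> R" "r \<in> carrier A" using R(1) by auto
    have "\<exists>e. Some r \<cdot>\<^bsub>A\<^esub> Some a \<cdot>\<^bsub>A\<^esub> Some a' = Some e \<and> e \<in> g {d}"
      if b: "b \<in> carrier B" "b' \<in> carrier B" "app B b b' = Some d" and a: "a \<in> g {b}" "a' \<in> g {b'}"
      for b b' d a a'
    proof -
      have "app (T B) {b} {b'} = Some {d}"
        using b(3) by (simp add: app_T_eq_Some_iff)
      then obtain \<rho> e where \<rho>: "app (T A) R (g {b}) = Some \<rho>" "app (T A) \<rho> (g {b'}) = Some e" "e \<subseteq> g {d}"
        using R(2)[of "{b}" "{b'}" "{d}"] b by (auto simp: term_app_eq_Some_iff)
      obtain x where x: "x \<in> \<rho>" "app A r a = Some x"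
        using app_T_SomeD(1)[OF \<rho>(1) r(1) a(1)] by auto
      obtain y where "y \<in> e" "app A x a' = Some y"
        using app_T_SomeD(1)[OF \<rho>(2) x(1) a(2)] by auto
      then show ?thesis using x \<rho>(3) by auto
    qed
    then show "\<exists>r\<in>carrier A. \<forall>a\<in>carrier B. \<forall>a'\<in>carrier B. \<forall>d. app B a a' = Some d \<longrightarrow>
         (\<forall>b\<in>g {a}. \<forall>b'\<in>g {a'}. \<exists>e. Some r \<cdot>\<^bsub>A\<^esub> Some b \<cdot>\<^bsub>A\<^esub> Some b' = Some e \<and> e \<in> g {d})"
      using r(2) by blast
  qed
  have "order_morphism_le (T B) (T B) (tilde \<gamma> \<circ> g) id"
    using assms by (simp add: right_adjoint_def)
  then obtain S where S: "S \<in> carrier (T B)" "\<And>\<beta>. \<beta> \<in> carrier (T B) \<Longrightarrow>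
      \<exists>e. app (T B) S (tilde \<gamma> (g \<beta>)) = Some e \<and> (e, \<beta>) \<in> le (T B)"
    unfolding order_morphism_le_def by auto
  obtain s where s: "s \<in> S" "s \<in> carrier B" using S(1) by auto
  have "app B s y = Some b" if "b \<in> carrier B" "a \<in> g {b}" "y \<in> \<gamma> a" for b a y
  proof -
    obtain e where e: "app (T B) S (tilde \<gamma> (g {b})) = Some e" "e \<subseteq> {b}"
      using S(2)[of "{b}"] \<open>b \<in> carrier B\<close> by auto
    moreover have "y \<in> tilde \<gamma> (g {b})" using that(2,3) by (auto simp: tilde_def)
    ultimately show ?thesis
      using app_T_SomeD(1)[OF e(1) s(1)] by blast
  qed
  then show "morphism_le B B (morphism_comp \<gamma> (\<lambda>b. g {b})) morphism_id"
    unfolding morphism_le_def morphism_comp_def morphism_id_def using s(2) by blast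
qed

text \<open>The element \<open>m\<close> must be chosen before \<open>b\<close>. It can be, because
  \<open>b\<close> is stored inside \<open>A\<close> as some \<open>d\<close> in
  \<open>\<delta> b\<close> and is recovered uniformly by \<open>s\<close> from any realizer of
  \<open>d\<close>.\<close>

lemma section_imp_computationally_dense:
  assumes "applicative_morphism B A \<delta>" and "morphism_le B B (morphism_comp \<gamma> \<delta>) morphism_id"
  shows "computationally_dense A B \<gamma>"
proof -
  interpret \<delta>: applicative_morphism B A \<delta> by fact
  obtain s where s: "s \<in> carrier B"
    "\<And>b a y. b \<in> carrier B \<Longrightarrow> a \<in> \<delta> b \<Longrightarrow> y \<in> \<gamma> a \<Longrightarrow> app B s y = Some b"
    using assms(2) by (fastforce simp: morphism_le_def morphism_comp_def morphism_id_def)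
  obtain i where i: "i \<in> carrier B" "\<And>b. b \<in> carrier B \<Longrightarrow> app B i b = Some b"
    using B.identity_realizer by blast
  \<comment> \<open>The first component is decoded by \<open>s\<close> and the second is left
    unchanged by \<open>i\<close>. For a code of \<open>d\<close> and \<open>a'\<close> with
    \<open>d\<close> in \<open>\<delta> b\<close>, the value of \<open>m\<close> is
    \<open>s x (i x') = b x'\<close> whenever \<open>b x'\<close> is defined.\<close>
  obtain p m where p: "p \<in> carrier A" and m: "m \<in> carrier B"
    and pm: "\<And>a. a \<in> carrier A \<Longrightarrow> \<exists>pa\<in>carrier A. app A p a = Some pa \<and>
        (\<forall>a'\<in>carrier A. \<exists>c\<in>carrier A. app A pa a' = Some c \<and>
          (\<forall>y\<in>\<gamma> c. \<exists>x\<in>\<gamma> a. \<exists>x'\<in>\<gamma> a'. \<forall>v. app B s x \<cdot>\<^bsub>B\<^esub> app B i x' = Some v \<longrightarrow> app B m y = Some v))"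
    using decode_apply[OF s(1) i(1)] by blast
  have "\<exists>a\<in>carrier A. \<forall>a'\<in>carrier A. elt_set_defined B b (\<gamma> a') \<longrightarrow>
        (\<exists>d. app A a a' = Some d \<and> elt_set_defined B m (\<gamma> d) \<and>
             elt_set_app B m (\<gamma> d) \<subseteq> elt_set_app B b (\<gamma> a'))" if b: "b \<in> carrier B" for b
  proof -
    \<comment> \<open>The witness of density for \<open>b\<close> is \<open>pd\<close>, the value of
      \<open>p\<close> at \<open>d\<close>: it sends \<open>a'\<close> to the code of the pair of
      \<open>d\<close> and \<open>a'\<close>.\<close>
    obtain d where d: "d \<in> \<delta> b" "d \<in> carrier A"
      using \<delta>.nonempty_subset[OF b] by blast
    obtain pd where pd: "pd \<in> carrier A" "\<And>a'. a' \<in> carrier A \<Longrightarrow>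
        \<exists>c\<in>carrier A. app A pd a' = Some c \<and>
          (\<forall>y\<in>\<gamma> c. \<exists>x\<in>\<gamma> d. \<exists>x'\<in>\<gamma> a'. \<forall>v. app B s x \<cdot>\<^bsub>B\<^esub> app B i x' = Some v \<longrightarrow> app B m y = Some v)"
      using pm[OF d(2)] by blast
    have "\<exists>c. app A pd a' = Some c \<and> elt_set_defined B m (\<gamma> c) \<and>
             elt_set_app B m (\<gamma> c) \<subseteq> elt_set_app B b (\<gamma> a')"
      if a': "a' \<in> carrier A" and "elt_set_defined B b (\<gamma> a')" for a'
    proof -
      obtain c where c: "app A pd a' = Some c" "\<And>y. y \<in> \<gamma> c \<Longrightarrow>
          \<exists>x\<in>\<gamma> d. \<exists>x'\<in>\<gamma> a'. \<forall>v. app B s x \<cdot>\<^bsub>B\<^esub> app B i x' = Some v \<longrightarrow> app B m y = Some v"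
        using pd(2)[OF a'] by blast
      \<comment> \<open>The decoded \<open>x'\<close> depends on \<open>y\<close> and may be any
        realizer of \<open>a'\<close>. This suffices, as density asks only for an inclusion of sets
        of values.\<close>
      have "\<exists>x'\<in>\<gamma> a'. \<exists>v. app B b x' = Some v \<and> app B m y = Some v" if y: "y \<in> \<gamma> c" for y
      proof -
        obtain x x' where x: "x \<in> \<gamma> d" "x' \<in> \<gamma> a'"
          "\<And>v. app B s x \<cdot>\<^bsub>B\<^esub> app B i x' = Some v \<Longrightarrow> app B m y = Some v"
          using c(2)[OF y] by blast
        obtain v where "app B b x' = Some v"
          using \<open>elt_set_defined B b (\<gamma> a')\<close> x(2) by (auto simp: elt_set_defined_def)
        then show ?thesis
          using x s(2)[OF b d(1) x(1)] i(2)[OF carrier_value[OF a' x(2)]] by auto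
      qed
      then show ?thesis
        using c(1) by (fastforce simp: elt_set_defined_def elt_set_app_def)
    qed
    then show ?thesis using pd(1) by blast
  qed
  then show ?thesis unfolding computationally_dense_def using m by blast
qed

end

theorem corollary2p3:
  fixes A :: "('a, 'y) pas_scheme" and B :: "('b, 'z) pas_scheme"
    and \<gamma> :: "'a \<Rightarrow> 'b set"
  assumes "pca A" and "pca B" and "applicative_morphism A B \<gamma>"
  shows "(computationally_dense A B \<gamma> \<longleftrightarrow> (\<exists>g. right_adjoint (T A) (T B) (tilde \<gamma>) g)) \<and>
         ((\<exists>g. right_adjoint (T A) (T B) (tilde \<gamma>) g) \<longleftrightarrow>
          (\<exists>\<delta>. applicative_morphism B A \<delta> \<and> morphism_le B B (morphism_comp \<gamma> \<delta>) morphism_id))"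
proof -
  interpret applicative_morphism A B \<gamma> by fact
  show ?thesis
    using computationally_dense_imp_right_adjoint right_adjoint_imp_section
      section_imp_computationally_dense by blast
qed

end
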